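(* Let $\mathcal M=(M,\rho)$ be a pseudo-metric space consisting of $n$ points, and let $\varphi_{\mathcal M}:M\to\ell_\infty^n$ be the Kuratowski isometry. Then there exists a minimal filling $\mathcal G$ for $\mathcal M$, and the corresponding Kuratowski network $\Gamma_{\mathcal G}$ is a shortest network in the space $\ell_\infty^n$ joining the set $\varphi_{\mathcal M}(M)$. Conversely, each shortest network on $\varphi_{\mathcal M}(M)$ (that is, each shortest network in $\ell_\infty^n$ joining $\varphi_{\mathcal M}(M)$) is isometric to some minimal filling of the space $\mathcal M$.
   Context: In a pseudo-metric space the distance between distinct points may be $0$. A graph $G=(V,E)$ (finite) joins $M$ if it is connected and $M\subset V$; then $M$ is its boundary. For a weight function $\omega:E\to[0,\infty)$, $d_\omega(u,v)$ is the least weight (sum of $\omega$ over edges) of a path in $G$ joining $u$ and $v$, and $\omega(G)=\sum_{e\in E}\omega(e)$. The weighted graph $(G,\omega)$ is a filling of $\mathcal M=(M,\rho)$ if $G$ joins $M$ and $\rho(p,q)\le d_\omega(p,q)$ for all $p,q\in M$. $\mathrm{mf}(\mathcal M)$ is the infimum of $\omega(G)$ over all fillings of $\mathcal M$ (over all $G$), and a minimal filling is a filling of weight $\mathrm{mf}(\mathcal M)$. Networks. A network of type $G=(V,E)$ ($G$ a connected graph) in a pseudo-metric space $(X,d)$ is a map $\Gamma:V\to X$ (parameterized by $G$); its length is $d(\Gamma)=\sum_{vw\in E}d(\Gamma(v),\Gamma(w))$. It joins a finite set $N\subset X$ if $N\subset\Gamma(V)$. A shortest network joining $N$ is a network joining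 $N$ whose length equals the infimum of the lengths of all networks (of all types) joining $N$. The weight function induced by $\Gamma$ is $\omega_\Gamma(vw)=d(\Gamma(v),\Gamma(w))$. A network $\Gamma$ of type $G$ and a weighted graph $\mathcal H$ are isometric if the weighted graphs $\mathcal H$ and $(G,\omega_\Gamma)$ are isomorphic. Kuratowski isometry. $\ell_\infty^n$ is $\mathbb R^n$ with the norm $\|v\|_\infty=\max_i|v^i|$. If $M=\{p_1,\dots,p_n\}$, then $\varphi_{\mathcal M}(p_i)=(\rho(p_i,p_1),\dots,\rho(p_i,p_n))$. Kuratowski network. For a filling $\mathcal G=(G,\omega)$ of $\mathcal M$, $G=(V,E)$, let $\bar G$ be the multigraph with vertex set $V$ whose edge set is the disjoint union of $E$ and the edge set of the complete graph on $M$, with the weight function $\bar\omega$ equal to $\omega$ on $E$ and to $\rho(p_i,p_j)$ on the edge $p_ip_j$ of the complete graph. Let $d_{\bar\omega}$ be the corresponding pseudo-metric on $V$ (least weight of a path in $\bar G$). The Kuratowski network for $\mathcal G$ is $\Gamma_{\mathcal G}:V\to\ell_\infty^n$, $\Gamma_{\mathcal G}(v)=(d_{\bar\omega}(v,p_1),\dots,d_{\bar\omega}(v,p_n))$.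
   Formalization: The converse is proved only for shortest networks in which distinct points of M are carried by distinct vertices; this is automatic when ρ is a metric, and without it the converse fails (M={p,q}, ρ=0, one-vertex network). *)

theory Defs
  imports "HOL-Analysis.Analysis"
begin

definition pseudo_metric_on :: "'a set \<Rightarrow> ('a \<Rightarrow> 'a \<Rightarrow> real) \<Rightarrow> bool" where
  "pseudo_metric_on M \<rho> \<longleftrightarrow>
     (\<forall>x\<in>M. \<rho> x x = 0) \<and>
     (\<forall>x\<in>M. \<forall>y\<in>M. 0 \<le> \<rho> x y) \<and>
     (\<forall>x\<in>M. \<forall>y\<in>M. \<rho> x y = \<rho> y x) \<and>
     (\<forall>x\<in>M. \<forall>y\<in>M. \<forall>z\<in>M. \<rho> x z \<le> \<rho> x y + \<rho> y z)"

(* Multigraphs have an edge set E with an incidence map ends sending an edge to its set of end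
   points. A simple graph has E :: 'v set set and ends = id. Paths may repeat vertices;
   for nonnegative weights this does not affect the least weight of a path. *)

inductive walk :: "'e set \<Rightarrow> ('e \<Rightarrow> 'v set) \<Rightarrow> 'v \<Rightarrow> 'e list \<Rightarrow> 'v \<Rightarrow> bool"
  for E :: "'e set" and ends :: "'e \<Rightarrow> 'v set" where
  walk_Nil: "walk E ends u [] u"
| walk_Cons: "e \<in> E \<Longrightarrow> ends e = {u, v} \<Longrightarrow> walk E ends v es w \<Longrightarrow> walk E ends u (e # es) w"

definition path_dist ::
  "'e set \<Rightarrow> ('e \<Rightarrow> 'v set) \<Rightarrow> ('e \<Rightarrow> real) \<Rightarrow> 'v \<Rightarrow> 'v \<Rightarrow> real" where
  "path_dist E ends \<omega> u v = Inf {sum_list (map \<omega> es) | es. walk E ends u es v}"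

definition connected_graph :: "'v set \<Rightarrow> 'v set set \<Rightarrow> bool" where
  "connected_graph V E \<longleftrightarrow>
     finite V \<and> V \<noteq> {} \<and>
     (\<forall>e\<in>E. \<exists>u\<in>V. \<exists>v\<in>V. u \<noteq> v \<and> e = {u, v}) \<and>
     (\<forall>u\<in>V. \<forall>v\<in>V. \<exists>es. walk E id u es v)"

(* The value of a symmetric function of two points on an unordered pair. *)
definition edge_value :: "('a \<Rightarrow> 'a \<Rightarrow> real) \<Rightarrow> 'a set \<Rightarrow> real" where
  "edge_value f e = (THE r. \<exists>u v. e = {u, v} \<and> r = f u v)"

lemma edge_value_pair:
  assumes "f u v = f v u"
  shows "edge_value f {u, v} = f u v"
  unfolding edge_value_def using assms by (auto simp: doubleton_eq_iff)

definition weighted_graph_iso ::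
  "'v set \<Rightarrow> 'v set set \<Rightarrow> ('v set \<Rightarrow> real) \<Rightarrow> 'w set \<Rightarrow> 'w set set \<Rightarrow> ('w set \<Rightarrow> real) \<Rightarrow> bool" where
  "weighted_graph_iso V E \<omega> V' E' \<omega>' \<longleftrightarrow>
     (\<exists>f. bij_betw f V V' \<and> (image f) ` E = E' \<and> (\<forall>e\<in>E. \<omega>' (f ` e) = \<omega> e))"

(* The vertices of fillings live in 'a + nat, the point x of M being the vertex Inl x: the summand
   nat supplies enough extra vertices to represent every finite graph containing M, even if 'a is
   a finite type. *)

definition filling ::
  "'a set \<Rightarrow> ('a \<Rightarrow> 'a \<Rightarrow> real) \<Rightarrow>
   ('a + nat) set \<Rightarrow> ('a + nat) set set \<Rightarrow> (('a + nat) set \<Rightarrow> real) \<Rightarrow> bool" where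
  "filling M \<rho> V E \<omega> \<longleftrightarrow>
     connected_graph V E \<and> Inl ` M \<subseteq> V \<and> (\<forall>e\<in>E. 0 \<le> \<omega> e) \<and>
     (\<forall>x\<in>M. \<forall>y\<in>M. \<rho> x y \<le> path_dist E id \<omega> (Inl x) (Inl y))"

definition mf :: "'a set \<Rightarrow> ('a \<Rightarrow> 'a \<Rightarrow> real) \<Rightarrow> real" where
  "mf M \<rho> = Inf {sum \<omega> E | V E \<omega>. filling M \<rho> V E \<omega>}"

definition minimal_filling ::
  "'a set \<Rightarrow> ('a \<Rightarrow> 'a \<Rightarrow> real) \<Rightarrow>
   ('a + nat) set \<Rightarrow> ('a + nat) set set \<Rightarrow> (('a + nat) set \<Rightarrow> real) \<Rightarrow> bool" where
  "minimal_filling M \<rho> V E \<omega> \<longleftrightarrow> filling M \<rho> V E \<omega> \<and> sum \<omega> E = mf M \<rho>"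

(* A network of type (V, E) in the space of all points of type 'x with distance d; only the
   values of \<Gamma> on V matter. *)

definition induced_weight ::
  "('x \<Rightarrow> 'x \<Rightarrow> real) \<Rightarrow> ('v \<Rightarrow> 'x) \<Rightarrow> 'v set \<Rightarrow> real" where
  "induced_weight d \<Gamma> = edge_value (\<lambda>v w. d (\<Gamma> v) (\<Gamma> w))"

definition network_length ::
  "('x \<Rightarrow> 'x \<Rightarrow> real) \<Rightarrow> 'v set set \<Rightarrow> ('v \<Rightarrow> 'x) \<Rightarrow> real" where
  "network_length d E \<Gamma> = sum (induced_weight d \<Gamma>) E"

definition network_joins :: "'x set \<Rightarrow> 'v set \<Rightarrow> 'v set set \<Rightarrow> ('v \<Rightarrow> 'x) \<Rightarrow> bool" where
  "network_joins N V E \<Gamma> \<longleftrightarrow> connected_graph V E \<and> N \<subseteq> \<Gamma> ` V"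

(* The competing networks range over the graphs with vertices in nat, that is, over all finite
   graphs up to isomorphism, whatever the vertex type 'v of the network itself. *)
definition shortest_network ::
  "('x \<Rightarrow> 'x \<Rightarrow> real) \<Rightarrow> 'x set \<Rightarrow> 'v set \<Rightarrow> 'v set set \<Rightarrow> ('v \<Rightarrow> 'x) \<Rightarrow> bool" where
  "shortest_network d N V E \<Gamma> \<longleftrightarrow>
     network_joins N V E \<Gamma> \<and>
     network_length d E \<Gamma> =
       Inf {network_length d E' \<Gamma>' | (V' :: nat set) E' \<Gamma>'. network_joins N V' E' \<Gamma>'}"

definition linf_dist :: "real ^ 'n \<Rightarrow> real ^ 'n \<Rightarrow> real" where
  "linf_dist x y = infnorm (x - y)"

(* In the next two definitions p enumerates the n points of M by the index type 'n. *)

definition kuratowski_map ::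
  "('a \<Rightarrow> 'a \<Rightarrow> real) \<Rightarrow> ('n \<Rightarrow> 'a) \<Rightarrow> 'a \<Rightarrow> real ^ 'n" where
  "kuratowski_map \<rho> p x = (\<chi> i. \<rho> x (p i))"

definition complete_edges :: "'a set \<Rightarrow> 'a set set" where
  "complete_edges M = {{x, y} | x y. x \<in> M \<and> y \<in> M \<and> x \<noteq> y}"

definition kuratowski_network ::
  "'a set \<Rightarrow> ('a \<Rightarrow> 'a \<Rightarrow> real) \<Rightarrow> ('n \<Rightarrow> 'a) \<Rightarrow>
   ('a + nat) set set \<Rightarrow> (('a + nat) set \<Rightarrow> real) \<Rightarrow> 'a + nat \<Rightarrow> real ^ 'n" where
  "kuratowski_network M \<rho> p E \<omega> v =
     (\<chi> i. path_dist (E <+> complete_edges M) (case_sum id (image Inl))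
            (case_sum \<omega> (edge_value \<rho>)) v (Inl (p i)))"

(* If two points of M are at distance 0, they have the same Kuratowski image, and a shortest
   network joining the image may have fewer vertices than M has points (one vertex suffices if
   \<rho> = 0), hence need not be isometric to any filling of M. The condition below excludes this:
   distinct points of M are carried by distinct vertices. *)
definition separates_points ::
  "'a set \<Rightarrow> ('a \<Rightarrow> 'x) \<Rightarrow> 'v set \<Rightarrow> ('v \<Rightarrow> 'x) \<Rightarrow> bool" where
  "separates_points M \<phi> V \<Gamma> \<longleftrightarrow>
     (\<exists>\<iota>. inj_on \<iota> M \<and> \<iota> ` M \<subseteq> V \<and> (\<forall>x\<in>M. \<Gamma> (\<iota> x) = \<phi> x))"

(* For metric spaces it is satisfied by every network joining the Kuratowski image. *)
lemma separates_points_metric: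
  fixes p :: "'n::finite \<Rightarrow> 'a"
  assumes "pseudo_metric_on M \<rho>" and "bij_betw p UNIV M"
    and metric: "\<And>x y. x \<in> M \<Longrightarrow> y \<in> M \<Longrightarrow> \<rho> x y = 0 \<Longrightarrow> x = y"
    and joins: "network_joins (kuratowski_map \<rho> p ` M) V E \<Gamma>"
  shows "separates_points M (kuratowski_map \<rho> p) V \<Gamma>"
proof -
  have inj: "x = y"
    if "x \<in> M" "y \<in> M" and eq: "kuratowski_map \<rho> p x = kuratowski_map \<rho> p y" for x y
  proof -
    obtain i where i: "p i = y"
      using assms(2) \<open>y \<in> M\<close> unfolding bij_betw_def by blast
    have "\<rho> x y = \<rho> y y"
      using arg_cong[OF eq, of "\<lambda>z. z $ i"] i by (simp add: kuratowski_map_def)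
    also have "\<dots> = 0"
      using assms(1) \<open>y \<in> M\<close> by (simp add: pseudo_metric_on_def)
    finally show ?thesis
      using metric that by blast
  qed
  have "\<forall>x\<in>M. \<exists>v\<in>V. \<Gamma> v = kuratowski_map \<rho> p x"
    using joins unfolding network_joins_def by (metis image_iff subset_iff)
  then obtain \<iota> where \<iota>: "\<forall>x\<in>M. \<iota> x \<in> V \<and> \<Gamma> (\<iota> x) = kuratowski_map \<rho> p x"
    by metis
  have "inj_on \<iota> M"
    using \<iota> inj by (metis inj_onI)
  then show ?thesis
    unfolding separates_points_def using \<iota> by blast
qed

end

theory Submission
  imports Defs
begin

text \<open>Fillings of \<open>M\<close> and networks joining the Kuratowski image of \<open>M\<close> have the same least
  weight, because each can be turned into the other without increasing the weight.

  The Kuratowski network of a filling maps every vertex to its vector of distances to \<open>M\<close> in the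
  enlarged graph. It is 1-Lipschitz on edges (\<open>kuratowski_network_length_le\<close>), and by the filling
  condition the added edges create no shortcuts, so that it extends the Kuratowski map
  (\<open>kuratowski_network_Inl\<close>). Conversely, the weight induced by a network satisfies the filling
  condition, since the Kuratowski map is an isometry (\<open>network_filling\<close>). If several points of
  \<open>M\<close> have the same image and the network provides only one vertex for them, then the missing
  vertices are attached as leaves by edges of length zero (\<open>network_filling_leaves\<close>). Hence
  \<open>mf_eq_shortest_length\<close>, and both directions of the correspondence follow.

  It remains to see that the least weight is attained. For a fixed graph this is a compactness
  argument (\<open>filling_min_weight_fixed_graph\<close>). That finitely many graphs suffice is shown on the
  side of networks, where vertices can be merged: a network joining \<open>k\<close> points can be
  replaced by one that is no longer and has at most \<open>3k\<close> vertices (\<open>network_few_vertices\<close>).\<close>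

section \<open>Walks and connected graphs\<close>

lemma walk_edges_subset: "walk E ends u es v \<Longrightarrow> set es \<subseteq> E"
  by (induction rule: walk.induct) auto

lemma walk_edge: "e \<in> E \<Longrightarrow> ends e = {u, v} \<Longrightarrow> walk E ends u [e] v"
  by (blast intro: walk.intros)

lemma walk_append:
  "walk E ends u es v \<Longrightarrow> walk E ends v fs w \<Longrightarrow> walk E ends u (es @ fs) w"
  by (induction rule: walk.induct) (auto intro: walk.intros)

lemma walk_rev: "walk E ends u es v \<Longrightarrow> walk E ends v (rev es) u"
proof (induction rule: walk.induct)
  case (walk_Cons e u v es w)
  have "walk E ends v [e] u"
    using walk_Cons by (intro walk_edge) auto
  then show ?case
    using walk_append[OF walk_Cons.IH] by simp
qed (simp add: walk.intros)

lemma walk_mono: "walk E ends u es v \<Longrightarrow> E \<subseteq> F \<Longrightarrow> walk F ends u es v"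
  by (induction rule: walk.induct) (auto intro: walk.intros)

lemma walk_leaves_set:
  assumes "walk E ends u es v" "u \<in> S" "v \<notin> S"
  shows "\<exists>e\<in>E. \<exists>a b. ends e = {a, b} \<and> a \<in> S \<and> b \<notin> S"
  using assms
proof (induction rule: walk.induct)
  case (walk_Cons e u v es w)
  then show ?case
    by (cases "v \<in> S") auto
qed simp

lemma walk_image:
  assumes "walk E id u es v"
    and F: "\<And>a b. {a, b} \<in> E \<Longrightarrow> f a \<noteq> f b \<Longrightarrow> {f a, f b} \<in> F"
  shows "\<exists>fs. walk F id (f u) fs (f v)"
  using assms(1)
proof (induction rule: walk.induct)
  case (walk_Nil u)
  show ?case
    by (blast intro: walk.intros)
next
  case (walk_Cons e u v es w)
  then obtain fs where fs: "walk F id (f v) fs (f w)"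
    by blast
  show ?case
  proof (cases "f u = f v")
    case True
    then show ?thesis
      using fs by metis
  next
    case False
    then have "{f u, f v} \<in> F"
      using F walk_Cons by auto
    then have "walk F id (f u) ({f u, f v} # fs) (f w)"
      using fs by (intro walk.walk_Cons) auto
    then show ?thesis
      by blast
  qed
qed

lemma connected_graph_walk:
  "connected_graph V E \<Longrightarrow> u \<in> V \<Longrightarrow> v \<in> V \<Longrightarrow> \<exists>es. walk E id u es v"
  by (simp add: connected_graph_def)

lemma connected_graph_edge:
  assumes "connected_graph V E" "e \<in> E"
  obtains u v where "u \<in> V" "v \<in> V" "u \<noteq> v" "e = {u, v}"
proof -
  have "\<exists>u\<in>V. \<exists>v\<in>V. u \<noteq> v \<and> e = {u, v}"
    using assms by (simp add: connected_graph_def)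
  then show ?thesis
    using that by blast
qed

lemma connected_graph_edge_subset: "connected_graph V E \<Longrightarrow> e \<in> E \<Longrightarrow> e \<subseteq> V"
  by (erule (1) connected_graph_edge) auto

lemma connected_graph_finite:
  assumes "connected_graph V E"
  shows "finite V" "finite E"
proof -
  show "finite V"
    using assms by (simp add: connected_graph_def)
  moreover have "E \<subseteq> Pow V"
    using connected_graph_edge_subset[OF assms] by blast
  ultimately show "finite E"
    by (meson finite_Pow_iff finite_subset)
qed

lemma connected_graph_rootI:
  assumes "finite V" "r \<in> V"
    and "\<And>e. e \<in> E \<Longrightarrow> \<exists>u\<in>V. \<exists>v\<in>V. u \<noteq> v \<and> e = {u, v}"
    and "\<And>v. v \<in> V \<Longrightarrow> \<exists>es. walk E id r es v"
  shows "connected_graph V E"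
  unfolding connected_graph_def
proof (intro conjI ballI)
  fix u v assume "u \<in> V" "v \<in> V"
  then obtain es fs where "walk E id r es u" "walk E id r fs v"
    using assms(4) by blast
  then show "\<exists>es. walk E id u es v"
    using walk_append walk_rev by metis
qed (use assms in auto)

lemma connected_graph_image:
  assumes "connected_graph V E"
  shows "connected_graph (f ` V) {{f u, f v} |u v. {u, v} \<in> E \<and> f u \<noteq> f v}"
  unfolding connected_graph_def
proof (intro conjI ballI)
  let ?F = "{{f u, f v} |u v. {u, v} \<in> E \<and> f u \<noteq> f v}"
  show "finite (f ` V)" "f ` V \<noteq> {}"
    using assms unfolding connected_graph_def by auto
  fix e assume "e \<in> ?F"
  then obtain u v where uv: "{u, v} \<in> E" "f u \<noteq> f v" "e = {f u, f v}"
    by auto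
  then have "u \<in> V" "v \<in> V"
    using connected_graph_edge_subset[OF assms uv(1)] by simp_all
  then show "\<exists>u\<in>f ` V. \<exists>v\<in>f ` V. u \<noteq> v \<and> e = {u, v}"
    using uv by blast
next
  let ?F = "{{f u, f v} |u v. {u, v} \<in> E \<and> f u \<noteq> f v}"
  fix a b assume "a \<in> f ` V" "b \<in> f ` V"
  then obtain u v where uv: "u \<in> V" "v \<in> V" "a = f u" "b = f v"
    by auto
  then obtain es where "walk E id u es v"
    using assms unfolding connected_graph_def by blast
  then show "\<exists>es. walk ?F id a es b"
    unfolding uv by (rule walk_image) auto
qed

lemma connected_graph_inj_image:
  assumes "connected_graph V E" "inj_on f V"
  shows "connected_graph (f ` V) ((image f) ` E)"
proof -
  have "(image f) ` E = {{f u, f v} |u v. {u, v} \<in> E \<and> f u \<noteq> f v}" (is "?L = ?R")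
  proof
    show "?R \<subseteq> ?L"
    proof
      fix e' assume "e' \<in> ?R"
      then obtain u v where "{u, v} \<in> E" "e' = f ` {u, v}"
        by auto
      then show "e' \<in> ?L"
        by blast
    qed
    show "?L \<subseteq> ?R"
    proof
      fix e' assume "e' \<in> ?L"
      then obtain e where e: "e \<in> E" "e' = f ` e"
        by blast
      obtain u v where "u \<in> V" "v \<in> V" "u \<noteq> v" "e = {u, v}"
        by (rule connected_graph_edge[OF assms(1) e(1)])
      then have "{u, v} \<in> E" "f u \<noteq> f v" "e' = {f u, f v}"
        using assms(2) e by (auto dest: inj_onD)
      then show "e' \<in> ?R"
        by blast
    qed
  qed
  then show ?thesis
    using connected_graph_image[OF assms(1), of f] by simp
qed

lemma connected_graph_insert_leaf:
  assumes "connected_graph V E" "a \<in> V" "b \<notin> V"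
  shows "connected_graph (insert b V) (insert {a, b} E)"
proof (rule connected_graph_rootI[where r = a])
  show "\<exists>es. walk (insert {a, b} E) id a es v" if v: "v \<in> insert b V" for v
  proof (cases "v = b")
    case True
    have "walk (insert {a, b} E) id a [{a, b}] b"
      by (intro walk_edge) auto
    then show ?thesis
      using True by blast
  next
    case False
    then obtain es where "walk E id a es v"
      using assms v unfolding connected_graph_def by blast
    then show ?thesis
      by (meson walk_mono subset_insertI)
  qed
  show "\<exists>u\<in>insert b V. \<exists>v\<in>insert b V. u \<noteq> v \<and> e = {u, v}" if "e \<in> insert {a, b} E" for e
  proof (cases "e = {a, b}")
    case True
    then show ?thesis
      using assms(2,3) by (intro bexI[of _ a] bexI[of _ b]) auto
  next
    case False
    then have "e \<in> E"
      using that by blast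
    from assms(1) this obtain u v where "u \<in> V" "v \<in> V" "u \<noteq> v" "e = {u, v}"
      by (rule connected_graph_edge)
    then show ?thesis
      by (intro bexI[of _ u] bexI[of _ v]) auto
  qed
qed (use assms connected_graph_finite in auto)

text \<open>The subgraph obtained is a spanning tree; only its number of edges matters.\<close>

lemma connected_graph_spanning:
  assumes "connected_graph V E"
  obtains F where "F \<subseteq> E" "connected_graph V F" "card F < card V"
proof -
  have finV: "finite V"
    using assms connected_graph_finite by blast
  \<comment> \<open>The tree grows by one edge at a time, leaving the set of vertices reached so far.\<close>
  have "\<exists>S F. S \<subseteq> V \<and> F \<subseteq> E \<and> connected_graph S F \<and> card S = Suc k \<and> card F \<le> k"
    if "Suc k \<le> card V" for k
    using that
  proof (induction k)
    case 0
    obtain r where "r \<in> V"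
      using assms by (auto simp: connected_graph_def)
    moreover have "connected_graph {r} {}"
      by (rule connected_graph_rootI[where r = r]) (auto intro: walk.intros)
    ultimately show ?case
      by (intro exI[of _ "{r}"] exI[of _ "{}"]) auto
  next
    case (Suc k)
    then obtain S F where SF: "S \<subseteq> V" "F \<subseteq> E" "connected_graph S F" "card S = Suc k" "card F \<le> k"
      by auto
    then obtain s t where "s \<in> S" "t \<in> V" "t \<notin> S"
      using Suc.prems by (metis Suc_n_not_le_n card_gt_0_iff equals0I subsetI subset_antisym zero_less_Suc)
    moreover obtain es where "walk E id s es t"
      using assms calculation SF(1) unfolding connected_graph_def by blast
    ultimately obtain a b where ab: "{a, b} \<in> E" "a \<in> S" "b \<notin> S"
      using walk_leaves_set[of E id s es t S] by auto
    have "b \<in> V"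
      using connected_graph_edge_subset[OF assms ab(1)] by simp
    moreover have "connected_graph (insert b S) (insert {a, b} F)"
      using SF ab by (intro connected_graph_insert_leaf)
    moreover have "card (insert b S) = Suc (Suc k)"
      using SF ab connected_graph_finite(1) by (metis card_insert_disjoint)
    moreover have "card (insert {a, b} F) \<le> Suc k"
      using SF by (metis card_insert_le_m1 diff_Suc_1 zero_less_Suc)
    ultimately show ?case
      using SF ab by (intro exI[of _ "insert b S"] exI[of _ "insert {a, b} F"]) auto
  qed
  moreover have "Suc (card V - 1) = card V"
    using finV assms by (simp add: connected_graph_def card_gt_0_iff)
  ultimately obtain S F where SF: "S \<subseteq> V" "F \<subseteq> E" "connected_graph S F" "card S = card V"
      "card F \<le> card V - 1" "card F < card V"
    by (metis le_imp_less_Suc order_refl)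
  then have "S = V"
    using card_subset_eq[OF finV] by blast
  then show ?thesis
    using that SF by blast
qed

lemma sum_degrees:
  assumes "connected_graph V E"
  shows "(\<Sum>v\<in>V. card {e\<in>E. v \<in> e}) = 2 * card E"
proof -
  have fin: "finite V" "finite E"
    using assms connected_graph_finite by blast+
  have "(\<Sum>v\<in>V. card {e\<in>E. v \<in> e}) = (\<Sum>v\<in>V. \<Sum>e\<in>E. if v \<in> e then 1 else 0)"
    using fin by (simp flip: sum.inter_filter)
  also have "\<dots> = (\<Sum>e\<in>E. \<Sum>v\<in>V. if v \<in> e then 1 else 0)"
    by (rule sum.swap)
  also have "\<dots> = (\<Sum>e\<in>E. 2)"
  proof (rule sum.cong)
    fix e assume e: "e \<in> E"
    obtain u v where uv: "u \<in> V" "v \<in> V" "u \<noteq> v" "e = {u, v}"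
      by (rule connected_graph_edge[OF assms e])
    then have "V \<inter> {x. x \<in> e} = {u, v}"
      by auto
    then show "(\<Sum>v\<in>V. if v \<in> e then 1 else 0) = (2::nat)"
      using fin uv by (simp add: sum.If_cases)
  qed simp
  finally show ?thesis
    by simp
qed

section \<open>Lengths of networks\<close>

lemma pseudo_metric_UNIV:
  assumes "pseudo_metric_on UNIV d"
  shows "d x x = 0" "0 \<le> d x y" "d x y = d y x" "d x z \<le> d x y + d y z"
  using assms by (simp_all add: pseudo_metric_on_def)

lemma induced_weight_pair:
  assumes "pseudo_metric_on UNIV d"
  shows "induced_weight d \<Gamma> {u, v} = d (\<Gamma> u) (\<Gamma> v)"
  unfolding induced_weight_def
  by (rule edge_value_pair[where f = "\<lambda>v w. d (\<Gamma> v) (\<Gamma> w)"]) (rule pseudo_metric_UNIV(3)[OF assms])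

lemma induced_weight_nonneg:
  assumes "pseudo_metric_on UNIV d" "connected_graph V E" "e \<in> E"
  shows "0 \<le> induced_weight d \<Gamma> e"
proof -
  obtain u v where "e = {u, v}"
    by (rule connected_graph_edge[OF assms(2,3)])
  then show ?thesis
    using pseudo_metric_UNIV(2)[OF assms(1)] by (simp add: induced_weight_pair[OF assms(1)])
qed

lemma inj_on_image_edges:
  assumes "connected_graph V E" "inj_on f V"
  shows "inj_on (image f) E"
proof (rule inj_onI)
  fix e e' assume e: "e \<in> E" "e' \<in> E" and eq: "f ` e = f ` e'"
  show "e = e'"
    using inj_on_image_eq_iff[OF assms(2)] e[THEN connected_graph_edge_subset[OF assms(1)]] eq
    by simp
qed

lemma induced_weight_relabel:
  assumes d: "pseudo_metric_on UNIV d" and E: "connected_graph V E" "inj_on f V" "e \<in> E"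
  shows "induced_weight d (\<Gamma> \<circ> inv_into V f) (f ` e) = induced_weight d \<Gamma> e"
proof -
  obtain u v where "u \<in> V" "v \<in> V" "u \<noteq> v" "e = {u, v}"
    by (rule connected_graph_edge[OF E(1,3)])
  then show ?thesis
    using E(2) by (simp add: induced_weight_pair[OF d])
qed

lemma network_length_relabel:
  assumes "pseudo_metric_on UNIV d" "connected_graph V E" "inj_on f V"
  shows "network_length d ((image f) ` E) (\<Gamma> \<circ> inv_into V f) = network_length d E \<Gamma>"
  unfolding network_length_def
  using assms by (simp add: sum.reindex inj_on_image_edges induced_weight_relabel)

lemma network_joins_relabel:
  assumes "network_joins N V E \<Gamma>" "inj_on f V"
  shows "network_joins N (f ` V) ((image f) ` E) (\<Gamma> \<circ> inv_into V f)"
proof -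
  have "(\<Gamma> \<circ> inv_into V f) ` (f ` V) = \<Gamma> ` V"
    using assms(2) by (force simp: image_image)
  then show ?thesis
    using assms by (simp add: network_joins_def connected_graph_inj_image)
qed

text \<open>Every network has a copy on an initial segment of the natural numbers; this bounds its
  vertex set once the number of vertices is bounded.\<close>

lemma network_nat:
  fixes V :: "'v set"
  assumes d: "pseudo_metric_on UNIV d" and N: "network_joins N V E \<Gamma>"
  obtains E' :: "nat set set" and \<Gamma>'
  where "network_joins N {..<card V} E' \<Gamma>'" "network_length d E' \<Gamma>' = network_length d E \<Gamma>"
proof -
  have G: "connected_graph V E"
    using N by (simp add: network_joins_def)
  then obtain f where f: "bij_betw f V {..<card V}"
    using ex_bij_betw_finite_nat connected_graph_finite(1) by (metis atLeast0LessThan)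
  then have "inj_on f V" "f ` V = {..<card V}"
    by (auto simp: bij_betw_def)
  then show ?thesis
    using that network_joins_relabel[OF N] network_length_relabel[OF d G] by metis
qed

text \<open>Merging a vertex \<open>v\<close> of degree at most two into a neighbour \<open>u\<close> does not increase the length:
  the edge \<open>vu\<close> disappears, and a second edge \<open>vw\<close>, if any, becomes \<open>uw\<close>, which is no longer than
  \<open>vu\<close> and \<open>vw\<close> together.\<close>

lemma network_merge:
  assumes d: "pseudo_metric_on UNIV d" and G: "connected_graph V E"
    and uv: "{u, v} \<in> E" "u \<noteq> v" and deg: "card {e\<in>E. v \<in> e} \<le> 2"
  shows "\<exists>E'. connected_graph (V - {v}) E' \<and> network_length d E' \<Gamma> \<le> network_length d E \<Gamma>"
proof -
  let ?w = "induced_weight d \<Gamma>"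
  define f where "f = id(v := u)"
  let ?E' = "{{f a, f b} |a b. {a, b} \<in> E \<and> f a \<noteq> f b}"
  have finE: "finite E"
    using G connected_graph_finite by blast
  have uV: "u \<in> V" "v \<in> V"
    using connected_graph_edge_subset[OF G uv(1)] by simp_all
  then have "f ` V = V - {v}"
    using uv by (auto simp: f_def image_iff)
  then have conn: "connected_graph (V - {v}) ?E'"
    using connected_graph_image[OF G, of f] by simp
  have nonneg: "0 \<le> ?w (f ` e)" if "e \<in> E" for e
  proof -
    obtain a b where "e = {a, b}"
      by (rule connected_graph_edge[OF G \<open>e \<in> E\<close>])
    then show ?thesis
      using pseudo_metric_UNIV(2)[OF d] by (simp add: induced_weight_pair[OF d])
  qed
  obtain e0 where e0: "{e\<in>E. v \<in> e} - {{u, v}} \<subseteq> {e0}"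
  proof -
    define D where "D = {e\<in>E. v \<in> e} - {{u, v}}"
    have "{u, v} \<in> {e\<in>E. v \<in> e}"
      using uv by simp
    then have "card D = card {e\<in>E. v \<in> e} - 1"
      unfolding D_def by (rule card_Diff_singleton)
    then have "card D \<le> Suc 0"
      using deg by linarith
    moreover have "finite D"
      using finE by (simp add: D_def)
    ultimately have D: "\<forall>x\<in>D. \<forall>y\<in>D. x = y"
      by (simp add: card_le_Suc0_iff_eq)
    show ?thesis
    proof (cases "D = {}")
      case True
      then show ?thesis
        using that unfolding D_def by blast
    next
      case False
      then obtain x where "x \<in> D"
        by blast
      then have "D \<subseteq> {x}"
        using D by blast
      then show ?thesis
        unfolding D_def by (rule that)
    qed
  qed
  have step: "?w (f ` e) \<le> ?w e + (if e = e0 then ?w {u, v} else 0)" if e: "e \<in> E - {{u, v}}" for e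
  proof -
    obtain a b where ab: "a \<noteq> b" "e = {a, b}"
      by (rule connected_graph_edge[OF G]) (use e in auto)
    show ?thesis
    proof (cases "v \<in> e")
      case True
      then have "e = e0"
        using e e0 by blast
      obtain x where x: "x \<noteq> v" "e = {v, x}"
      proof (cases "a = v")
        case True
        then show ?thesis
          using that[of b] ab by simp
      next
        case False
        then show ?thesis
          using that[of a] ab \<open>v \<in> e\<close> by auto
      qed
      have "f ` e = {u, x}"
        using x by (simp add: f_def insert_commute)
      then have "?w (f ` e) = d (\<Gamma> u) (\<Gamma> x)" "?w e = d (\<Gamma> v) (\<Gamma> x)"
        using x(2) by (simp_all only: induced_weight_pair[OF d])
      then show ?thesis
        using pseudo_metric_UNIV(4)[OF d, of "\<Gamma> u" "\<Gamma> x" "\<Gamma> v"] \<open>e = e0\<close>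
        by (simp add: induced_weight_pair[OF d])
    next
      case False
      then have "f ` e = e"
        by (auto simp: f_def)
      then show ?thesis
        using pseudo_metric_UNIV(2)[OF d] by (simp add: induced_weight_pair[OF d])
    qed
  qed
  have "?E' \<subseteq> (image f) ` (E - {{u, v}})"
  proof
    fix e assume "e \<in> ?E'"
    then obtain a b where ab: "e = {f a, f b}" "{a, b} \<in> E" "f a \<noteq> f b"
      by blast
    moreover have "{a, b} \<noteq> {u, v}"
      using ab(3) uv by (auto simp: f_def doubleton_eq_iff)
    ultimately show "e \<in> (image f) ` (E - {{u, v}})"
      by (intro image_eqI[of _ _ "{a, b}"]) auto
  qed
  then have "sum ?w ?E' \<le> sum ?w ((image f) ` (E - {{u, v}}))"
    using finE nonneg by (intro sum_mono2) auto
  also have "\<dots> \<le> (\<Sum>e\<in>E - {{u, v}}. ?w (f ` e))"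
    using finE nonneg sum_image_le[of "E - {{u, v}}" ?w "image f"] by (simp add: o_def)
  also have "\<dots> \<le> (\<Sum>e\<in>E - {{u, v}}. ?w e + (if e = e0 then ?w {u, v} else 0))"
    by (intro sum_mono step)
  also have "\<dots> \<le> (\<Sum>e\<in>E - {{u, v}}. ?w e) + ?w {u, v}"
    using finE uv pseudo_metric_UNIV(2)[OF d] by (simp add: sum.distrib induced_weight_pair[OF d])
  also have "\<dots> = sum ?w E"
    using finE uv by (simp add: sum_diff1)
  finally show ?thesis
    using conn unfolding network_length_def by blast
qed

text \<open>A network can be replaced by one that is no longer and has at most three times as many
  vertices as there are points to join. In a larger network, choose one vertex for each of these
  points; the other vertices make up more than two thirds of all. Since a spanning tree has average
  degree below two, one of them has degree at most two in it and can be merged into a neighbour.\<close>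

lemma network_few_vertices:
  assumes d: "pseudo_metric_on UNIV d" and N: "finite N" "N \<noteq> {}" and "network_joins N V E \<Gamma>"
  shows "\<exists>V' E'. network_joins N V' E' \<Gamma> \<and> network_length d E' \<Gamma> \<le> network_length d E \<Gamma> \<and>
           card V' \<le> 3 * card N"
  using assms(4)
proof (induction "card V" arbitrary: V E rule: less_induct)
  case less
  have G: "connected_graph V E" and NV: "N \<subseteq> \<Gamma> ` V"
    using less.prems by (auto simp: network_joins_def)
  show ?case
  proof (cases "card V \<le> 3 * card N")
    case True
    then show ?thesis
      using less.prems by blast
  next
    case False
    obtain F where F: "F \<subseteq> E" "connected_graph V F" "card F < card V"
      using G connected_graph_spanning by blast
    have fin: "finite V" "finite E"
      using G connected_graph_finite by blast+
    obtain T where T: "T \<subseteq> V" "\<Gamma> ` T = N" "inj_on \<Gamma> T"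
      using NV unfolding subset_image_inj by auto
    have cardT: "finite T" "card T = card N"
      using finite_subset[OF T(1) fin(1)] card_image[OF T(3)] T(2) by simp_all
    have "\<exists>v\<in>V - T. card {e\<in>F. v \<in> e} \<le> 2"
    proof (rule ccontr)
      assume "\<not> ?thesis"
      then have "3 \<le> card {e\<in>F. v \<in> e}" if "v \<in> V - T" for v
        using that by (metis Suc_leI eval_nat_numeral(3) not_le)
      then have "3 * card (V - T) \<le> (\<Sum>v\<in>V - T. card {e\<in>F. v \<in> e})"
        using sum_bounded_below[of "V - T" "3::nat" "\<lambda>v. card {e\<in>F. v \<in> e}"]
        by (simp add: mult.commute)
      also have "\<dots> \<le> (\<Sum>v\<in>V. card {e\<in>F. v \<in> e})"
        using fin by (intro sum_mono2) auto
      also have "\<dots> = 2 * card F"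
        by (rule sum_degrees[OF F(2)])
      finally have "3 * card (V - T) < 2 * card V"
        using F(3) by linarith
      moreover have "card (V - T) = card V - card N"
        using T cardT by (simp add: card_Diff_subset)
      ultimately show False
        using False by linarith
    qed
    then obtain v where v: "v \<in> V" "v \<notin> T" "card {e\<in>F. v \<in> e} \<le> 2"
      by blast
    obtain t where t: "t \<in> T"
      using T N by blast
    then obtain es where "walk F id v es t"
      using connected_graph_walk[OF F(2)] T v by blast
    then have "\<exists>e\<in>F. \<exists>a b. id e = {a, b} \<and> a \<in> {v} \<and> b \<notin> {v}"
      by (rule walk_leaves_set) (use t v in auto)
    then obtain u where u: "{u, v} \<in> F" "u \<noteq> v"
      by (auto simp: insert_commute)
    obtain E' where E': "connected_graph (V - {v}) E'"
        "network_length d E' \<Gamma> \<le> network_length d F \<Gamma>"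
      using network_merge[OF d F(2) u v(3)] by blast
    have "network_length d F \<Gamma> \<le> network_length d E \<Gamma>"
      unfolding network_length_def using F fin induced_weight_nonneg[OF d G]
      by (intro sum_mono2) blast+
    moreover have "network_joins N (V - {v}) E' \<Gamma>"
      using E' T v by (auto simp: network_joins_def)
    moreover have "card (V - {v}) < card V"
      using v fin by (intro card_Diff1_less)
    ultimately show ?thesis
      using less.hyps[of "V - {v}" E'] E'(2) by (meson order.trans)
  qed
qed

lemma network_exists:
  assumes "finite N" "N \<noteq> {}"
  shows "\<exists>(V :: nat set) E \<Gamma>. network_joins N V E \<Gamma>"
proof -
  obtain \<Gamma> where \<Gamma>: "bij_betw \<Gamma> {0..<card N} N"
    using assms ex_bij_betw_nat_finite by blast
  let ?V = "{0..<card N}"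
  have "\<exists>es. walk (complete_edges ?V) id u es v" if "u \<in> ?V" "v \<in> ?V" for u v
  proof (cases "u = v")
    case True
    then show ?thesis
      by (blast intro: walk.intros)
  next
    case False
    then have "walk (complete_edges ?V) id u [{u, v}] v"
      using that by (intro walk_edge) (auto simp: complete_edges_def)
    then show ?thesis
      by blast
  qed
  moreover have "?V \<noteq> {}"
    using assms by (simp add: card_gt_0_iff)
  moreover have "\<exists>u\<in>?V. \<exists>v\<in>?V. u \<noteq> v \<and> e = {u, v}" if "e \<in> complete_edges ?V" for e
    using that unfolding complete_edges_def by blast
  ultimately have "connected_graph ?V (complete_edges ?V)"
    unfolding connected_graph_def by simp
  then show ?thesis
    using \<Gamma> unfolding network_joins_def bij_betw_def by blast
qed

section \<open>Fillings\<close>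

lemma filling_iff_walks:
  assumes "connected_graph V E" "Inl ` M \<subseteq> V" "\<And>e. e \<in> E \<Longrightarrow> 0 \<le> \<omega> e"
  shows "filling M \<rho> V E \<omega> \<longleftrightarrow>
    (\<forall>x\<in>M. \<forall>y\<in>M. \<forall>es. walk E id (Inl x) es (Inl y) \<longrightarrow> \<rho> x y \<le> sum_list (map \<omega> es))"
proof -
  have "\<rho> x y \<le> path_dist E id \<omega> (Inl x) (Inl y) \<longleftrightarrow>
      (\<forall>es. walk E id (Inl x) es (Inl y) \<longrightarrow> \<rho> x y \<le> sum_list (map \<omega> es))"
    if xy: "x \<in> M" "y \<in> M" for x y
  proof -
    let ?W = "{sum_list (map \<omega> es) |es. walk E id (Inl x) es (Inl y)}"
    have "\<exists>es. walk E id (Inl x) es (Inl y)"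
      using assms(1,2) xy unfolding connected_graph_def by (simp add: image_subset_iff)
    then have ne: "?W \<noteq> {}"
      by blast
    have "0 \<le> w" if w: "w \<in> ?W" for w
    proof -
      obtain es where es: "w = sum_list (map \<omega> es)" "walk E id (Inl x) es (Inl y)"
        using w by blast
      show ?thesis
        unfolding es(1) by (rule sum_list_nonneg) (use assms(3) walk_edges_subset[OF es(2)] in auto)
    qed
    then have bdd: "bdd_below ?W"
      by (rule bdd_belowI)
    have "\<rho> x y \<le> Inf ?W \<longleftrightarrow> (\<forall>w\<in>?W. \<rho> x y \<le> w)"
      using ne bdd by (rule le_cInf_iff)
    then show ?thesis
      unfolding path_dist_def by auto
  qed
  then show ?thesis
    using assms by (simp add: filling_def)
qed

lemma path_dist_le_walk:
  assumes "\<And>e. e \<in> E \<Longrightarrow> 0 \<le> \<omega> e" "walk E ends u es v"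
  shows "path_dist E ends \<omega> u v \<le> sum_list (map \<omega> es)"
  unfolding path_dist_def
proof (rule cInf_lower)
  show "bdd_below {sum_list (map \<omega> es) |es. walk E ends u es v}"
  proof (rule bdd_belowI)
    fix w assume "w \<in> {sum_list (map \<omega> es) |es. walk E ends u es v}"
    then obtain fs where fs: "w = sum_list (map \<omega> fs)" "walk E ends u fs v"
      by blast
    show "0 \<le> w"
      unfolding fs(1) by (rule sum_list_nonneg) (use assms(1) walk_edges_subset[OF fs(2)] in auto)
  qed
qed (use assms(2) in blast)

lemma path_dist_geI:
  assumes "\<exists>es. walk E ends u es v"
    and "\<And>es. walk E ends u es v \<Longrightarrow> c \<le> sum_list (map \<omega> es)"
  shows "c \<le> path_dist E ends \<omega> u v"
  unfolding path_dist_def by (rule cInf_greatest) (use assms in auto)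

lemma path_dist_edge:
  assumes "\<And>e. e \<in> E \<Longrightarrow> 0 \<le> \<omega> e" "e \<in> E" "ends e = {u, v}" "\<exists>es. walk E ends v es w"
  shows "path_dist E ends \<omega> u w \<le> \<omega> e + path_dist E ends \<omega> v w"
proof -
  have "path_dist E ends \<omega> u w - \<omega> e \<le> path_dist E ends \<omega> v w"
  proof (rule path_dist_geI[OF assms(4)])
    fix es assume "walk E ends v es w"
    then have "walk E ends u (e # es) w"
      using assms by (intro walk_Cons)
    then have "path_dist E ends \<omega> u w \<le> sum_list (map \<omega> (e # es))"
      using assms(1) by (intro path_dist_le_walk)
    then show "path_dist E ends \<omega> u w - \<omega> e \<le> sum_list (map \<omega> es)"
      by simp
  qed
  then show ?thesis
    by simp
qed

lemma filling_weight_nonneg: "filling M \<rho> V E \<omega> \<Longrightarrow> 0 \<le> sum \<omega> E"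
  unfolding filling_def by (intro sum_nonneg) blast

text \<open>On a fixed graph the fillings of bounded weight form a compact set: the weights lie in a
  bounded interval, and the filling condition is a family of closed conditions, one for each walk
  between points of \<open>M\<close>. Hence the least weight is attained.\<close>

lemma filling_min_weight_fixed_graph:
  assumes f0: "filling M \<rho> V E \<omega>0"
  shows "\<exists>\<omega>. filling M \<rho> V E \<omega> \<and> (\<forall>\<omega>'. filling M \<rho> V E \<omega>' \<longrightarrow> sum \<omega> E \<le> sum \<omega>' E)"
proof -
  define c where "c = sum \<omega>0 E"
  have G: "connected_graph V E" and MV: "Inl ` M \<subseteq> V"
    using f0 by (simp_all add: filling_def)
  have finE: "finite E"
    using G by (rule connected_graph_finite)
  define P where "P = {(x, y, es). x \<in> M \<and> y \<in> M \<and> walk E id (Inl x) es (Inl y)}"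
  define K where "K = (PiE UNIV (\<lambda>_. {0..c}) :: (('a + nat) set \<Rightarrow> real) set)"
  define S where "S = K \<inter> (\<Inter>(x, y, es)\<in>P. {\<omega>. \<rho> x y \<le> sum_list (map \<omega> es)})"
  have filling_S: "filling M \<rho> V E \<omega>" if "\<omega> \<in> S" for \<omega>
  proof -
    have "0 \<le> \<omega> e" for e
      using that by (auto simp: S_def K_def PiE_iff)
    moreover have "\<rho> x y \<le> sum_list (map \<omega> es)"
      if "x \<in> M" "y \<in> M" "walk E id (Inl x) es (Inl y)" for x y es
      using that \<open>\<omega> \<in> S\<close> by (auto simp: S_def P_def)
    ultimately show ?thesis
      using filling_iff_walks[OF G MV] by blast
  qed
  \<comment> \<open>The values of a weight function outside \<open>E\<close> are irrelevant, but \<open>K\<close> constrains them too;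
    they are reset to zero.\<close>
  have S_filling: "(\<lambda>e. if e \<in> E then \<omega> e else 0) \<in> S"
    if \<omega>: "filling M \<rho> V E \<omega>" "sum \<omega> E \<le> c" for \<omega>
  proof -
    let ?\<omega> = "\<lambda>e. if e \<in> E then \<omega> e else 0"
    have nonneg: "0 \<le> \<omega> e" if "e \<in> E" for e
      using \<omega>(1) that by (simp add: filling_def)
    have "?\<omega> e \<in> {0..c}" for e
    proof (cases "e \<in> E")
      case True
      then have "\<omega> e \<le> sum \<omega> E"
        using finE nonneg by (intro member_le_sum) auto
      then show ?thesis
        using True \<omega>(2) nonneg by simp
    next
      case False
      have "0 \<le> c"
        unfolding c_def using f0 by (rule filling_weight_nonneg)
      then show ?thesis
        using False by simp
    qed
    moreover have "\<rho> x y \<le> sum_list (map ?\<omega> es)" if "(x, y, es) \<in> P" for x y es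
    proof -
      have xy: "x \<in> M" "y \<in> M" and es: "walk E id (Inl x) es (Inl y)"
        using that by (simp_all add: P_def)
      have "map ?\<omega> es = map \<omega> es"
        using walk_edges_subset[OF es] by auto
      moreover have "\<rho> x y \<le> sum_list (map \<omega> es)"
        using filling_iff_walks[where \<omega> = \<omega>, OF G MV nonneg] \<omega>(1) xy es by blast
      ultimately show ?thesis
        by (simp only:)
    qed
    ultimately show ?thesis
      unfolding S_def K_def by auto
  qed
  have "compactin (product_topology (\<lambda>_. euclidean) UNIV) K"
    unfolding K_def by (simp add: compactin_PiE compactin_euclidean_iff)
  then have "compact K"
    by (simp add: euclidean_product_topology compactin_euclidean_iff)
  moreover have cont: "continuous_on UNIV (\<lambda>\<omega>::('a + nat) set \<Rightarrow> real. sum_list (map \<omega> es))" for es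
    by (induction es) (auto intro!: continuous_intros)
  then have "closed {\<omega>::('a + nat) set \<Rightarrow> real. \<rho> x y \<le> sum_list (map \<omega> es)}" for x y es
    by (intro closed_Collect_le) auto
  then have "closed (\<Inter>(x, y, es)\<in>P. {\<omega>::('a + nat) set \<Rightarrow> real. \<rho> x y \<le> sum_list (map \<omega> es)})"
    by (intro closed_INT) auto
  ultimately have "compact S"
    unfolding S_def by (rule compact_Int_closed)
  moreover have "S \<noteq> {}"
    using S_filling[OF f0] by (auto simp: c_def)
  moreover have "continuous_on S (\<lambda>\<omega>. sum \<omega> E)"
    by (intro continuous_on_sum continuous_on_subset[OF continuous_on_product_coordinates]) auto
  ultimately obtain \<omega> where \<omega>: "\<omega> \<in> S" "\<And>\<omega>'. \<omega>' \<in> S \<Longrightarrow> sum \<omega> E \<le> sum \<omega>' E"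
    using continuous_attains_inf[of S "\<lambda>\<omega>. sum \<omega> E"] by blast
  have "sum \<omega> E \<le> sum \<omega>' E" if \<omega>': "filling M \<rho> V E \<omega>'" for \<omega>'
  proof (cases "sum \<omega>' E \<le> c")
    case True
    have "sum \<omega> E \<le> (\<Sum>e\<in>E. if e \<in> E then \<omega>' e else 0)"
      by (rule \<omega>(2)[OF S_filling[OF \<omega>' True]])
    then show ?thesis
      by simp
  next
    case False
    have "sum \<omega> E \<le> (\<Sum>e\<in>E. if e \<in> E then \<omega>0 e else 0)"
      by (rule \<omega>(2)[OF S_filling[OF f0]]) (simp add: c_def)
    then show ?thesis
      using False by (simp add: c_def)
  qed
  then show ?thesis
    using filling_S[OF \<omega>(1)] by blast
qed

section \<open>The maximum norm and the Kuratowski map\<close>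

lemma linf_dist_pseudo_metric: "pseudo_metric_on UNIV (linf_dist :: real ^ 'n \<Rightarrow> real ^ 'n \<Rightarrow> real)"
  unfolding pseudo_metric_on_def linf_dist_def
proof (intro conjI ballI)
  show "infnorm (x - z) \<le> infnorm (x - y) + infnorm (y - z)" for x y z :: "real ^ 'n"
    using infnorm_triangle[of "x - y" "y - z"] by simp
  show "infnorm (x - y) = infnorm (y - x)" for x y :: "real ^ 'n"
    by (rule infnorm_sub)
qed (simp_all add: infnorm_pos_le infnorm_0)

lemma linf_dist_component: "\<bar>x $ i - y $ i\<bar> \<le> linf_dist x y"
  unfolding linf_dist_def using component_le_infnorm_cart[of "x - y" i] by simp

lemma linf_dist_le:
  assumes "\<And>i. \<bar>x $ i - y $ i\<bar> \<le> c"
  shows "linf_dist x y \<le> c"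
  unfolding linf_dist_def infnorm_cart by (rule cSup_least) (use assms in auto)

lemma induced_weight_walk:
  assumes d: "pseudo_metric_on UNIV d" and "walk E id u es v"
  shows "d (\<Gamma> u) (\<Gamma> v) \<le> sum_list (map (induced_weight d \<Gamma>) es)"
  using assms(2)
proof (induction rule: walk.induct)
  case (walk_Nil u)
  show ?case
    by (simp add: pseudo_metric_UNIV(1)[OF d])
next
  case (walk_Cons e u v es w)
  have "e = {u, v}"
    using walk_Cons.hyps by simp
  then have "induced_weight d \<Gamma> e = d (\<Gamma> u) (\<Gamma> v)"
    by (simp only: induced_weight_pair[OF d])
  then show ?case
    using walk_Cons.IH pseudo_metric_UNIV(4)[OF d, of "\<Gamma> u" "\<Gamma> w" "\<Gamma> v"] by simp
qed

context
  fixes M :: "'a set" and \<rho> :: "'a \<Rightarrow> 'a \<Rightarrow> real" and p :: "'n::finite \<Rightarrow> 'a"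
  assumes pm: "pseudo_metric_on M \<rho>" and p: "bij_betw p UNIV M"
begin

lemma rho_pseudo_metric:
  assumes "x \<in> M" "y \<in> M"
  shows "\<rho> x x = 0" "0 \<le> \<rho> x y" "\<rho> x y = \<rho> y x" "z \<in> M \<Longrightarrow> \<rho> x z \<le> \<rho> x y + \<rho> y z"
  using pm assms by (simp_all add: pseudo_metric_on_def)

lemma p_in_M: "p i \<in> M"
  using bij_betw_apply[OF p, of i] by simp

lemma finite_M: "finite M"
  using bij_betw_finite[OF p] by simp

lemma M_nonempty: "M \<noteq> {}"
  using p_in_M[of undefined] by auto

lemma kuratowski_dist_ge:
  assumes "x \<in> M" "y \<in> M"
  shows "\<rho> x y \<le> linf_dist (kuratowski_map \<rho> p x) (kuratowski_map \<rho> p y)"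
proof -
  obtain i where i: "y = p i"
    using p assms(2) unfolding bij_betw_def by blast
  have "\<bar>\<rho> x (p i) - \<rho> y (p i)\<bar> \<le> linf_dist (kuratowski_map \<rho> p x) (kuratowski_map \<rho> p y)"
    using linf_dist_component[of "kuratowski_map \<rho> p x" i "kuratowski_map \<rho> p y"]
    by (simp add: kuratowski_map_def)
  then show ?thesis
    using rho_pseudo_metric(1)[OF assms(2,2)] rho_pseudo_metric(2)[OF assms] by (simp flip: i)
qed

section \<open>From networks to fillings\<close>

lemma network_filling:
  assumes G: "connected_graph V E" and MV: "Inl ` M \<subseteq> V"
    and \<Gamma>: "\<And>x. x \<in> M \<Longrightarrow> \<Gamma> (Inl x) = kuratowski_map \<rho> p x"
  shows "filling M \<rho> V E (induced_weight linf_dist \<Gamma>)"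
proof -
  have "\<rho> x y \<le> sum_list (map (induced_weight linf_dist \<Gamma>) es)"
    if "x \<in> M" "y \<in> M" "walk E id (Inl x) es (Inl y)" for x y es
    using kuratowski_dist_ge[OF that(1,2)]
      induced_weight_walk[OF linf_dist_pseudo_metric that(3), of \<Gamma>] \<Gamma> that(1,2) by simp
  then show ?thesis
    using filling_iff_walks[where \<omega> = "induced_weight linf_dist \<Gamma>",
        OF G MV induced_weight_nonneg[OF linf_dist_pseudo_metric G]] by blast
qed

text \<open>A network joining the Kuratowski image need not have a separate vertex for each point of
  \<open>M\<close>. Such vertices are attached as leaves, by edges of length zero.\<close>

lemma network_filling_leaves:
  fixes V :: "nat set"
  assumes "network_joins (kuratowski_map \<rho> p ` M) V E \<Gamma>"
  shows "\<exists>E' \<omega>. filling M \<rho> (Inl ` M \<union> Inr ` V) E' \<omega> \<and> sum \<omega> E' = network_length linf_dist E \<Gamma>"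
proof -
  note d = linf_dist_pseudo_metric
  have G: "connected_graph V E" and joins: "kuratowski_map \<rho> p ` M \<subseteq> \<Gamma> ` V"
    using assms by (simp_all add: network_joins_def)
  have "\<forall>x\<in>M. \<exists>v. v \<in> V \<and> \<Gamma> v = kuratowski_map \<rho> p x"
    using joins by (metis image_iff subset_iff)
  then obtain \<kappa> where \<kappa>: "\<And>x. x \<in> M \<Longrightarrow> \<kappa> x \<in> V \<and> \<Gamma> (\<kappa> x) = kuratowski_map \<rho> p x"
    by metis
  define W :: "('a + nat) set" where "W = Inl ` M \<union> Inr ` V"
  define A :: "('a + nat) set set" where "A = (image Inr) ` E"
  define B where "B = (\<lambda>x. {Inl x, Inr (\<kappa> x)}) ` M"
  define \<Delta> where "\<Delta> = case_sum (kuratowski_map \<rho> p) \<Gamma>"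
  let ?w = "induced_weight linf_dist \<Delta>"
  have A: "connected_graph (Inr ` V) A"
    unfolding A_def by (intro connected_graph_inj_image G) simp
  obtain r where r: "r \<in> V"
    using G unfolding connected_graph_def by blast
  have conn: "connected_graph W (A \<union> B)"
  proof (rule connected_graph_rootI[where r = "Inr r"])
    show "finite W" "Inr r \<in> W"
      using finite_M connected_graph_finite(1)[OF G] r by (simp_all add: W_def)
    show "\<exists>u\<in>W. \<exists>v\<in>W. u \<noteq> v \<and> e = {u, v}" if "e \<in> A \<union> B" for e
    proof (cases "e \<in> A")
      case True
      with A obtain u v where "u \<in> Inr ` V" "v \<in> Inr ` V" "u \<noteq> v" "e = {u, v}"
        by (rule connected_graph_edge)
      then show ?thesis
        unfolding W_def by blast
    next
      case False
      then obtain x where "x \<in> M" "e = {Inl x, Inr (\<kappa> x)}"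
        using \<open>e \<in> A \<union> B\<close> by (auto simp: B_def)
      then show ?thesis
        using \<kappa> by (intro bexI[of _ "Inl x"] bexI[of _ "Inr (\<kappa> x)"]) (auto simp: W_def)
    qed
    have inner: "\<exists>es. walk (A \<union> B) id (Inr r) es (Inr v)" if v: "v \<in> V" for v
    proof -
      obtain es where "walk A id (Inr r) es (Inr v)"
        using connected_graph_walk[OF A, of "Inr r" "Inr v"] r v by blast
      then show ?thesis
        using walk_mono[of A id _ es _ "A \<union> B"] by blast
    qed
    show "\<exists>es. walk (A \<union> B) id (Inr r) es w" if w: "w \<in> W" for w
    proof (cases w)
      case (Inl x)
      then have x: "x \<in> M"
        using w by (auto simp: W_def)
      then obtain es where es: "walk (A \<union> B) id (Inr r) es (Inr (\<kappa> x))"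
        using inner \<kappa> by blast
      have "walk (A \<union> B) id (Inr (\<kappa> x)) [{Inl x, Inr (\<kappa> x)}] (Inl x)"
        by (rule walk_edge) (use x in \<open>auto simp: B_def\<close>)
      with es have "walk (A \<union> B) id (Inr r) (es @ [{Inl x, Inr (\<kappa> x)}]) (Inl x)"
        by (rule walk_append)
      then show ?thesis
        using Inl by blast
    next
      case (Inr v)
      then show ?thesis
        using w inner by (auto simp: W_def)
    qed
  qed
  have "filling M \<rho> W (A \<union> B) ?w"
    by (rule network_filling[OF conn]) (auto simp: W_def \<Delta>_def)
  moreover have "sum ?w (A \<union> B) = network_length linf_dist E \<Gamma>"
  proof -
    have "?w e = 0" if e: "e \<in> B" for e
    proof -
      obtain x where x: "x \<in> M" "e = {Inl x, Inr (\<kappa> x)}"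
        using e by (auto simp: B_def)
      show ?thesis
        unfolding x(2) induced_weight_pair[OF d] using \<kappa>[OF x(1)]
        by (simp add: \<Delta>_def pseudo_metric_UNIV(1)[OF d])
    qed
    moreover have "finite A" "finite B"
      using connected_graph_finite(2)[OF A] finite_M by (simp_all add: B_def)
    moreover have "A \<inter> B = {}"
      unfolding A_def B_def by blast
    ultimately have "sum ?w (A \<union> B) = sum ?w A"
      by (simp add: sum.union_disjoint)
    also have "\<dots> = (\<Sum>e\<in>E. ?w (Inr ` e))"
      unfolding A_def by (simp add: sum.reindex[OF inj_on_image_edges[OF G]])
    also have "\<dots> = (\<Sum>e\<in>E. induced_weight linf_dist \<Gamma> e)"
    proof (rule sum.cong[OF refl])
      fix e assume e: "e \<in> E"
      obtain u v where "e = {u, v}"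
        by (rule connected_graph_edge[OF G e])
      then show "?w (Inr ` e) = induced_weight linf_dist \<Gamma> e"
        by (simp add: induced_weight_pair[OF d] \<Delta>_def)
    qed
    finally show ?thesis
      by (simp add: network_length_def)
  qed
  ultimately show ?thesis
    unfolding W_def by blast
qed

section \<open>From fillings to Kuratowski networks\<close>

context
  fixes V :: "('a + nat) set" and E \<omega>
  assumes fil: "filling M \<rho> V E \<omega>"
begin

text \<open>The weighted multigraph that enlarges the filling by the complete graph on \<open>M\<close>, as in
  \<open>kuratowski_network_def\<close>.\<close>

abbreviation bar_edges :: "(('a + nat) set + 'a set) set" where
  "bar_edges \<equiv> E <+> complete_edges M"

abbreviation bar_ends :: "('a + nat) set + 'a set \<Rightarrow> ('a + nat) set" where
  "bar_ends \<equiv> case_sum id (image Inl)"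

abbreviation bar_weight :: "('a + nat) set + 'a set \<Rightarrow> real" where
  "bar_weight \<equiv> case_sum \<omega> (edge_value \<rho>)"

lemma filling_graph: "connected_graph V E" "Inl ` M \<subseteq> V" "e \<in> E \<Longrightarrow> 0 \<le> \<omega> e"
  using fil by (simp_all add: filling_def)

lemma filling_walk:
  assumes "x \<in> M" "y \<in> M" "walk E id (Inl x) es (Inl y)"
  shows "\<rho> x y \<le> sum_list (map \<omega> es)"
  using filling_iff_walks[where \<omega> = \<omega>, OF filling_graph] fil assms by blast

lemma edge_value_rho:
  assumes "x \<in> M" "y \<in> M"
  shows "edge_value \<rho> {x, y} = \<rho> x y"
  using rho_pseudo_metric(3)[OF assms] by (rule edge_value_pair)

lemma bar_weight_nonneg:
  assumes "e \<in> bar_edges"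
  shows "0 \<le> bar_weight e"
proof (cases e)
  case (Inl e')
  then show ?thesis
    using assms filling_graph(3) by auto
next
  case (Inr e')
  then obtain x y where "x \<in> M" "y \<in> M" "e' = {x, y}"
    using assms by (auto simp: complete_edges_def)
  then show ?thesis
    using Inr edge_value_rho rho_pseudo_metric(2) by simp
qed

lemma walk_bar: "walk E id u es v \<Longrightarrow> walk bar_edges bar_ends u (map Inl es) v"
  by (induction rule: walk.induct) (auto intro: walk.intros)

lemma walk_bar_exists:
  assumes "u \<in> V" "x \<in> M"
  shows "\<exists>es. walk bar_edges bar_ends u es (Inl x)"
proof -
  have "Inl x \<in> V"
    using assms(2) filling_graph(2) by blast
  then obtain es where "walk E id u es (Inl x)"
    using connected_graph_walk[OF filling_graph(1)] assms(1) by blast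
  then show ?thesis
    using walk_bar by blast
qed

text \<open>Of a walk in the enlarged graph that ends in \<open>M\<close>, only the part before the first edge of the
  complete graph matters: after that, the filling condition bounds each stretch in \<open>E\<close> between
  points of \<open>M\<close> from below by a value of \<open>\<rho>\<close>, and the triangle inequality collapses the rest to
  a single value \<open>\<rho> x y\<close>.\<close>

lemma walk_bar_weight_ge:
  assumes "walk bar_edges bar_ends u es w" "w = Inl y" "y \<in> M"
  shows "\<exists>x\<in>M. \<exists>fs. walk E id u fs (Inl x) \<and> sum_list (map \<omega> fs) + \<rho> x y \<le> sum_list (map bar_weight es)"
  using assms
proof (induction rule: walk.induct)
  case (walk_Nil u)
  have "walk E id u [] (Inl y)"
    unfolding walk_Nil by (rule walk.walk_Nil)
  moreover have "sum_list (map \<omega> []) + \<rho> y y \<le> sum_list (map bar_weight [])"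
    using rho_pseudo_metric(1) walk_Nil.prems(2) by simp
  ultimately show ?case
    using walk_Nil.prems(2) by blast
next
  case (walk_Cons e u v es w)
  then obtain x fs where x: "x \<in> M" and fs: "walk E id v fs (Inl x)"
      and le: "sum_list (map \<omega> fs) + \<rho> x y \<le> sum_list (map bar_weight es)"
    by blast
  show ?case
  proof (cases e)
    case (Inl e')
    then have "e' \<in> E" "id e' = {u, v}"
      using walk_Cons.hyps by auto
    then have "walk E id u (e' # fs) (Inl x)"
      using fs by (rule walk.walk_Cons)
    moreover have "sum_list (map \<omega> (e' # fs)) + \<rho> x y \<le> sum_list (map bar_weight (e # es))"
      using le Inl by simp
    ultimately show ?thesis
      using x by blast
  next
    case (Inr e')
    then obtain a' b' where "a' \<in> M" "b' \<in> M" "e' = {a', b'}"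
      using walk_Cons.hyps by (auto simp: complete_edges_def)
    moreover from this have "{Inl a', Inl b'} = {u, v}"
      using walk_Cons.hyps Inr by simp
    ultimately obtain a b where ab: "a \<in> M" "b \<in> M" "e' = {a, b}" "u = Inl a" "v = Inl b"
      by (metis doubleton_eq_iff)
    have "\<rho> a y \<le> \<rho> a b + \<rho> b y" "\<rho> b y \<le> \<rho> b x + \<rho> x y"
      using rho_pseudo_metric(4) ab x walk_Cons.prems(2) by blast+
    moreover have "\<rho> b x \<le> sum_list (map \<omega> fs)"
      using ab x fs by (intro filling_walk) auto
    moreover have "bar_weight e = \<rho> a b"
      using Inr ab edge_value_rho by simp
    ultimately have "sum_list (map \<omega> []) + \<rho> a y \<le> sum_list (map bar_weight (e # es))"
      using le by simp
    moreover have "walk E id u [] (Inl a)"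
      unfolding ab(4) by (rule walk.walk_Nil)
    ultimately show ?thesis
      using ab(1) by blast
  qed
qed

lemma kuratowski_network_Inl:
  assumes "x \<in> M"
  shows "kuratowski_network M \<rho> p E \<omega> (Inl x) = kuratowski_map \<rho> p x"
proof -
  have "path_dist bar_edges bar_ends bar_weight (Inl x) (Inl (p i)) = \<rho> x (p i)" for i
  proof (rule antisym)
    show "\<rho> x (p i) \<le> path_dist bar_edges bar_ends bar_weight (Inl x) (Inl (p i))"
    proof (rule path_dist_geI)
      show "\<exists>es. walk bar_edges bar_ends (Inl x) es (Inl (p i))"
        using assms filling_graph(2) p_in_M by (intro walk_bar_exists) auto
      fix es assume "walk bar_edges bar_ends (Inl x) es (Inl (p i))"
      then obtain z fs where z: "z \<in> M" "walk E id (Inl x) fs (Inl z)"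
          "sum_list (map \<omega> fs) + \<rho> z (p i) \<le> sum_list (map bar_weight es)"
        using walk_bar_weight_ge p_in_M by blast
      have "\<rho> x (p i) \<le> \<rho> x z + \<rho> z (p i)"
        using rho_pseudo_metric(4) assms z(1) p_in_M by blast
      also have "\<rho> x z \<le> sum_list (map \<omega> fs)"
        using assms z(1,2) by (rule filling_walk)
      finally show "\<rho> x (p i) \<le> sum_list (map bar_weight es)"
        using z(3) by simp
    qed
    show "path_dist bar_edges bar_ends bar_weight (Inl x) (Inl (p i)) \<le> \<rho> x (p i)"
    proof (cases "x = p i")
      case True
      have "path_dist bar_edges bar_ends bar_weight (Inl x) (Inl x) \<le> sum_list (map bar_weight [])"
        by (intro path_dist_le_walk bar_weight_nonneg walk.walk_Nil)
      then show ?thesis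
        using rho_pseudo_metric(1)[OF assms assms] by (simp flip: True)
    next
      case False
      then have "{x, p i} \<in> complete_edges M"
        using assms p_in_M unfolding complete_edges_def by blast
      then have "walk bar_edges bar_ends (Inl x) [Inr {x, p i}] (Inl (p i))"
        by (intro walk_edge) auto
      then have "path_dist bar_edges bar_ends bar_weight (Inl x) (Inl (p i))
          \<le> sum_list (map bar_weight [Inr {x, p i}])"
        by (intro path_dist_le_walk bar_weight_nonneg)
      then show ?thesis
        using edge_value_rho[OF assms p_in_M] by simp
    qed
  qed
  then show ?thesis
    by (simp add: kuratowski_network_def kuratowski_map_def)
qed

lemma kuratowski_network_joins:
  "network_joins (kuratowski_map \<rho> p ` M) V E (kuratowski_network M \<rho> p E \<omega>)"
  unfolding network_joins_def
proof (intro conjI filling_graph image_subsetI)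
  fix x assume "x \<in> M"
  then show "kuratowski_map \<rho> p x \<in> kuratowski_network M \<rho> p E \<omega> ` V"
    using kuratowski_network_Inl[of x] filling_graph(2) by (metis image_eqI image_subset_iff)
qed

lemma kuratowski_network_length_le:
  "network_length linf_dist E (kuratowski_network M \<rho> p E \<omega>) \<le> sum \<omega> E"
  unfolding network_length_def
proof (rule sum_mono)
  fix e assume e: "e \<in> E"
  obtain u v where uv: "u \<in> V" "v \<in> V" "e = {u, v}"
    by (rule connected_graph_edge[OF filling_graph(1) e])
  let ?\<Gamma> = "kuratowski_network M \<rho> p E \<omega>"
  have step: "path_dist bar_edges bar_ends bar_weight a (Inl (p i))
      \<le> \<omega> e + path_dist bar_edges bar_ends bar_weight b (Inl (p i))"
    if ab: "b \<in> V" "e = {a, b}" for a b i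
  proof -
    have "path_dist bar_edges bar_ends bar_weight a (Inl (p i))
        \<le> bar_weight (Inl e) + path_dist bar_edges bar_ends bar_weight b (Inl (p i))"
    proof (rule path_dist_edge)
      show "Inl e \<in> bar_edges"
        using e by (rule InlI)
      show "bar_ends (Inl e) = {a, b}"
        using ab(2) by simp
    qed (rule bar_weight_nonneg, assumption, rule walk_bar_exists[OF ab(1) p_in_M])
    then show ?thesis
      by simp
  qed
  have "linf_dist (?\<Gamma> u) (?\<Gamma> v) \<le> \<omega> e"
  proof (rule linf_dist_le)
    fix i
    have "e = {v, u}"
      using uv(3) by (simp add: insert_commute)
    then show "\<bar>?\<Gamma> u $ i - ?\<Gamma> v $ i\<bar> \<le> \<omega> e"
      using step[OF uv(2,3), of i] step[OF uv(1), of v i]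
      by (simp add: kuratowski_network_def abs_le_iff)
  qed
  then show "induced_weight linf_dist ?\<Gamma> e \<le> \<omega> e"
    unfolding uv(3) induced_weight_pair[OF linf_dist_pseudo_metric] .
qed

end


section \<open>Minimal fillings and shortest networks\<close>

lemma filling_exists: "\<exists>V E \<omega>. filling M \<rho> V E \<omega>"
  using network_exists[of "kuratowski_map \<rho> p ` M"] finite_M M_nonempty network_filling_leaves
  by (metis finite_imageI image_is_empty)

lemma mf_le:
  assumes "filling M \<rho> V E \<omega>"
  shows "mf M \<rho> \<le> sum \<omega> E"
  unfolding mf_def
proof (rule cInf_lower)
  show "bdd_below {sum \<omega> E |V E \<omega>. filling M \<rho> V E \<omega>}"
    by (rule bdd_belowI[of _ 0]) (auto intro: filling_weight_nonneg)
qed (use assms in blast)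

lemma mf_ge:
  assumes "\<And>V E \<omega>. filling M \<rho> V E \<omega> \<Longrightarrow> c \<le> sum \<omega> E"
  shows "c \<le> mf M \<rho>"
  unfolding mf_def by (rule cInf_greatest) (use filling_exists assms in auto)

lemma minimal_filling_exists: "\<exists>V E \<omega>. minimal_filling M \<rho> V E \<omega>"
proof -
  note d = linf_dist_pseudo_metric
  define N where "N = kuratowski_map \<rho> p ` M"
  have N: "finite N" "N \<noteq> {}"
    using finite_M M_nonempty by (simp_all add: N_def)
  \<comment> \<open>By \<open>small\<close> below, it suffices to consider the finitely many graphs with vertices in \<open>W\<close>.\<close>
  define W :: "('a + nat) set" where "W = Inl ` M \<union> Inr ` {..<3 * card N}"
  define A where "A = {(V, E). V \<subseteq> W \<and> E \<subseteq> Pow W \<and> (\<exists>\<omega>. filling M \<rho> V E \<omega>)}"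
  have small: "\<exists>V' E' \<omega>'. (V', E') \<in> A \<and> filling M \<rho> V' E' \<omega>' \<and> sum \<omega>' E' \<le> sum \<omega> E"
    if fil: "filling M \<rho> V E \<omega>" for V E \<omega>
  proof -
    let ?\<Gamma> = "kuratowski_network M \<rho> p E \<omega>"
    obtain V1 E1 where 1: "network_joins N V1 E1 ?\<Gamma>"
        "network_length linf_dist E1 ?\<Gamma> \<le> network_length linf_dist E ?\<Gamma>" "card V1 \<le> 3 * card N"
      using network_few_vertices[OF d N kuratowski_network_joins[OF fil, folded N_def]] by blast
    obtain E2 \<Gamma>2 where 2: "network_joins N {..<card V1} E2 \<Gamma>2"
        "network_length linf_dist E2 \<Gamma>2 = network_length linf_dist E1 ?\<Gamma>"
      by (rule network_nat[OF d 1(1)])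
    obtain E3 \<omega>3 where 3: "filling M \<rho> (Inl ` M \<union> Inr ` {..<card V1}) E3 \<omega>3"
        "sum \<omega>3 E3 = network_length linf_dist E2 \<Gamma>2"
      using network_filling_leaves[OF 2(1)[unfolded N_def]] by blast
    have "Inl ` M \<union> Inr ` {..<card V1} \<subseteq> W"
      using 1(3) by (auto simp: W_def)
    moreover have "E3 \<subseteq> Pow (Inl ` M \<union> Inr ` {..<card V1})"
      using connected_graph_edge_subset[OF filling_graph(1)[OF 3(1)]] by blast
    ultimately have "(Inl ` M \<union> Inr ` {..<card V1}, E3) \<in> A"
      using 3(1) unfolding A_def by blast
    moreover have "sum \<omega>3 E3 \<le> sum \<omega> E"
      using 1(2) 2(2) 3(2) kuratowski_network_length_le[OF fil] by linarith
    ultimately show ?thesis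
      using 3(1) by blast
  qed
  have "A \<subseteq> Pow W \<times> Pow (Pow W)"
    unfolding A_def by auto
  moreover have "finite W"
    using finite_M by (simp add: W_def)
  ultimately have finA: "finite A"
    by (meson finite_Pow_iff finite_SigmaI finite_subset)
  have "\<forall>G\<in>A. \<exists>\<omega>. filling M \<rho> (fst G) (snd G) \<omega> \<and>
      (\<forall>\<omega>'. filling M \<rho> (fst G) (snd G) \<omega>' \<longrightarrow> sum \<omega> (snd G) \<le> sum \<omega>' (snd G))"
    using filling_min_weight_fixed_graph by (auto simp: A_def)
  then obtain opt where opt: "\<And>G. G \<in> A \<Longrightarrow> filling M \<rho> (fst G) (snd G) (opt G)"
      "\<And>G \<omega>'. G \<in> A \<Longrightarrow> filling M \<rho> (fst G) (snd G) \<omega>' \<Longrightarrow> sum (opt G) (snd G) \<le> sum \<omega>' (snd G)"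
    by metis
  have "A \<noteq> {}"
    using filling_exists small by blast
  then obtain G where G: "G \<in> A" "\<And>H. H \<in> A \<Longrightarrow> sum (opt G) (snd G) \<le> sum (opt H) (snd H)"
    using ex_min_if_finite[of "(\<lambda>G. sum (opt G) (snd G)) ` A"] finA by (force simp: not_less)
  have "sum (opt G) (snd G) \<le> sum \<omega> E" if fil: "filling M \<rho> V E \<omega>" for V E \<omega>
  proof -
    obtain V' E' \<omega>' where H: "(V', E') \<in> A" "filling M \<rho> V' E' \<omega>'" "sum \<omega>' E' \<le> sum \<omega> E"
      using small[OF fil] by blast
    have "sum (opt G) (snd G) \<le> sum (opt (V', E')) E'"
      using G(2)[OF H(1)] by simp
    also have "\<dots> \<le> sum \<omega>' E'"
      using opt(2)[OF H(1)] H(2) by simp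
    finally show ?thesis
      using H(3) by simp
  qed
  then have "sum (opt G) (snd G) \<le> mf M \<rho>"
    by (rule mf_ge)
  then have "minimal_filling M \<rho> (fst G) (snd G) (opt G)"
    using mf_le[OF opt(1)[OF G(1)]] opt(1)[OF G(1)] by (simp add: minimal_filling_def)
  then show ?thesis
    by blast
qed

lemma mf_le_network_length:
  assumes "network_joins (kuratowski_map \<rho> p ` M) V E \<Gamma>"
  shows "mf M \<rho> \<le> network_length linf_dist E \<Gamma>"
proof -
  obtain E1 \<Gamma>1 where 1: "network_joins (kuratowski_map \<rho> p ` M) {..<card V} E1 \<Gamma>1"
      "network_length linf_dist E1 \<Gamma>1 = network_length linf_dist E \<Gamma>"
    by (rule network_nat[OF linf_dist_pseudo_metric assms])
  then show ?thesis
    using network_filling_leaves[OF 1(1)] mf_le by fastforce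
qed

lemma mf_eq_shortest_length:
  "mf M \<rho> = Inf {network_length linf_dist E \<Gamma> |(V :: nat set) E \<Gamma>.
     network_joins (kuratowski_map \<rho> p ` M) V E \<Gamma>}" (is "_ = Inf ?L")
proof (rule antisym)
  show "mf M \<rho> \<le> Inf ?L"
  proof (rule cInf_greatest)
    show "?L \<noteq> {}"
      using network_exists[of "kuratowski_map \<rho> p ` M"] finite_M M_nonempty by blast
  qed (auto intro: mf_le_network_length)
  have bdd: "bdd_below ?L"
    by (rule bdd_belowI[of _ "mf M \<rho>"]) (auto intro: mf_le_network_length)
  show "Inf ?L \<le> mf M \<rho>"
  proof (rule mf_ge)
    fix V E \<omega> assume fil: "filling M \<rho> V E \<omega>"
    obtain E1 \<Gamma>1 where 1: "network_joins (kuratowski_map \<rho> p ` M) {..<card V} E1 \<Gamma>1"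
        "network_length linf_dist E1 \<Gamma>1 = network_length linf_dist E (kuratowski_network M \<rho> p E \<omega>)"
      by (rule network_nat[OF linf_dist_pseudo_metric kuratowski_network_joins[OF fil]])
    have "Inf ?L \<le> network_length linf_dist E1 \<Gamma>1"
      using 1(1) bdd by (intro cInf_lower) blast+
    then show "Inf ?L \<le> sum \<omega> E"
      using 1(2) kuratowski_network_length_le[OF fil] by simp
  qed
qed

lemma shortest_network_iff:
  "shortest_network linf_dist (kuratowski_map \<rho> p ` M) V E \<Gamma> \<longleftrightarrow>
     network_joins (kuratowski_map \<rho> p ` M) V E \<Gamma> \<and> network_length linf_dist E \<Gamma> = mf M \<rho>"
  unfolding shortest_network_def mf_eq_shortest_length ..

lemma kuratowski_network_shortest:
  assumes "minimal_filling M \<rho> V E \<omega>"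
  shows "shortest_network linf_dist (kuratowski_map \<rho> p ` M) V E (kuratowski_network M \<rho> p E \<omega>)"
proof -
  have fil: "filling M \<rho> V E \<omega>" and w: "sum \<omega> E = mf M \<rho>"
    using assms by (simp_all add: minimal_filling_def)
  have "network_length linf_dist E (kuratowski_network M \<rho> p E \<omega>) = mf M \<rho>"
    using kuratowski_network_length_le[OF fil] mf_le_network_length[OF kuratowski_network_joins[OF fil]] w
    by simp
  then show ?thesis
    using kuratowski_network_joins[OF fil] by (simp add: shortest_network_iff)
qed

lemma shortest_network_minimal_filling:
  fixes V :: "'v set"
  assumes short: "shortest_network linf_dist (kuratowski_map \<rho> p ` M) V E \<Gamma>"
    and sep: "separates_points M (kuratowski_map \<rho> p) V \<Gamma>"
  shows "\<exists>V' E' \<omega>'. minimal_filling M \<rho> V' E' \<omega>' \<and>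
    weighted_graph_iso V E (induced_weight linf_dist \<Gamma>) V' E' \<omega>'"
proof -
  note d = linf_dist_pseudo_metric
  have G: "connected_graph V E" and len: "network_length linf_dist E \<Gamma> = mf M \<rho>"
    using short unfolding shortest_network_iff by (simp_all add: network_joins_def)
  obtain \<iota> where \<iota>: "inj_on \<iota> M" "\<iota> ` M \<subseteq> V" "\<And>x. x \<in> M \<Longrightarrow> \<Gamma> (\<iota> x) = kuratowski_map \<rho> p x"
    using sep unfolding separates_points_def by blast
  obtain g :: "'v \<Rightarrow> nat" where g: "inj_on g V"
    using finite_imp_inj_to_nat_seg[OF connected_graph_finite(1)[OF G]] by blast
  define f :: "'v \<Rightarrow> 'a + nat"
    where "f v = (if v \<in> \<iota> ` M then Inl (inv_into M \<iota> v) else Inr (g v))" for v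
  have f: "inj_on f V"
  proof (rule inj_onI)
    fix u v assume "u \<in> V" "v \<in> V" "f u = f v"
    then show "u = v"
      using inj_onD[OF g] inj_on_inv_into[of "\<iota> ` M" \<iota> M]
      by (auto simp: f_def \<iota>(1) split: if_splits)
  qed
  have f_\<iota>: "f (\<iota> x) = Inl x" if "x \<in> M" for x
    using that \<iota>(1) by (simp add: f_def)
  define \<Delta> where "\<Delta> = \<Gamma> \<circ> inv_into V f"
  have G': "connected_graph (f ` V) ((image f) ` E)"
    using G f by (rule connected_graph_inj_image)
  have "filling M \<rho> (f ` V) ((image f) ` E) (induced_weight linf_dist \<Delta>)"
  proof (rule network_filling[OF G'])
    show "Inl ` M \<subseteq> f ` V"
    proof (rule image_subsetI)
      fix x assume "x \<in> M"
      then show "Inl x \<in> f ` V"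
        using f_\<iota> \<iota>(2) by (intro image_eqI[of _ _ "\<iota> x"]) auto
    qed
    fix x assume x: "x \<in> M"
    then have "inv_into V f (Inl x) = \<iota> x"
      using \<iota>(2) by (intro inv_into_f_eq[OF f] f_\<iota>) auto
    then show "\<Delta> (Inl x) = kuratowski_map \<rho> p x"
      using \<iota>(3)[OF x] by (simp add: \<Delta>_def)
  qed
  moreover have "sum (induced_weight linf_dist \<Delta>) ((image f) ` E) = mf M \<rho>"
    using network_length_relabel[OF d G f, of \<Gamma>] len by (simp add: network_length_def \<Delta>_def)
  ultimately have "minimal_filling M \<rho> (f ` V) ((image f) ` E) (induced_weight linf_dist \<Delta>)"
    by (simp add: minimal_filling_def)
  moreover have "weighted_graph_iso V E (induced_weight linf_dist \<Gamma>)
      (f ` V) ((image f) ` E) (induced_weight linf_dist \<Delta>)"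
    unfolding weighted_graph_iso_def \<Delta>_def
    using inj_on_imp_bij_betw[OF f] induced_weight_relabel[OF d G f] by blast
  ultimately show ?thesis
    by blast
qed

end

theorem corollary3p3:
  fixes M :: "'a set" and \<rho> :: "'a \<Rightarrow> 'a \<Rightarrow> real" and p :: "'n::finite \<Rightarrow> 'a"
  assumes "pseudo_metric_on M \<rho>" and "bij_betw p UNIV M"
  shows "(\<exists>V E \<omega>. minimal_filling M \<rho> V E \<omega>) \<and>
         (\<forall>V E \<omega>. minimal_filling M \<rho> V E \<omega> \<longrightarrow>
            shortest_network linf_dist (kuratowski_map \<rho> p ` M)
              V E (kuratowski_network M \<rho> p E \<omega>)) \<and>
         (\<forall>(V :: 'v set) E (\<Gamma> :: 'v \<Rightarrow> real ^ 'n).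
            shortest_network linf_dist (kuratowski_map \<rho> p ` M) V E \<Gamma> \<and>
            separates_points M (kuratowski_map \<rho> p) V \<Gamma> \<longrightarrow>
            (\<exists>V' E' \<omega>'. minimal_filling M \<rho> V' E' \<omega>' \<and>
               weighted_graph_iso V E (induced_weight linf_dist \<Gamma>) V' E' \<omega>'))"
  using minimal_filling_exists[OF assms] kuratowski_network_shortest[OF assms]
    shortest_network_minimal_filling[OF assms] by blast

end
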